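(* Let $\varphi$ be a linear groupoid identity and $m$ a positive integer. Let $X$ be the set of all bracketings of length $m$. Then all groupoids satisfying $\varphi$ are $m$AC-nice if and only if there is a bracketing $x\in X$ such that the group $G=W(\varphi,m)$ satisfies $P_x=S_m$ and $O_x=X$.
   Context: A groupoid is a set with one binary operation. A groupoid identity $u=v$ is linear of length $2n$ if the same $n$ variables occur in both terms $u$ and $v$, each exactly once on each side. A groupoid is $m$AC-nice if any two products of the same $m$ of its elements (with multiplicity; in arbitrary orders and with arbitrary bracketings) yield the same element. Maps are written on the right of their arguments and composed from left to right. A bracketing of length $m$ is a way of parenthesizing a product of $m$ factors (a full ordered binary tree with $m$ leaves); $X$, the set of bracketings of length $m$, has $C_m$ elements ($C_1=C_2=1$, $C_m=\sum_{k=1}^{m-1}C_kC_{m-k}$) and is identified with $\{0,\dots,C_m-1\}$. The identity-hedron $H(\varphi,m)$ is the labelled directed graph with vertex set $X$ defined as follows. Take a word $u_1\cdots u_m$ in $m$ distinct letters bracketed according to $i\in X$. A single application of $\varphi$ replaces one subterm that is a substitution instance of one of the sides of $\varphi$ (either side) by the corresponding instance of the other side. Each such application, producing a term bracketed according to $j$ in which the letter in position $p$ has moved to position $p\pi$, gives an arrow from $i$ to $j$ labelled by $\pi\in S_m$. Let $A=S_m$, $B=S_X$ (the symmetric group on $X$), and let $W$ be the wreath product $A\ \mathrm{wr}_X\ B=A^X\ltimes B$, whose elements are $((a_i)_{i\in X},a)$ with $a_i\in A$, $a\in B$, and whose multiplication is $((a_i),a)\cdot((b_i),b)=((a_ib_{ia}),ab)$.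 To an arrow from $i$ to $j$ labelled $\pi$ in $H(\varphi,m)$ (together with its inverse arrow) associate the element $((a_r),a)\in W$, where $a$ is the transposition $(i,j)$, $a_i=\pi$, $a_j=\pi^{-1}$, and $a_r$ is the identity for $r\notin\{i,j\}$; if $i=j$, then $a$ is the identity, $a_i=\pi$ and all other $a_r$ are the identity. $W(\varphi,m)$ is the subgroup of $W$ generated by the elements associated with all arrows of $H(\varphi,m)$. The group $G=W(\varphi,m)$ acts on $X$ by $x^{((p_i),p)}=xp$. For $x\in X$, $G_x$ is the stabilizer of $x$ in $G$, $O_x\subseteq X$ is the orbit of $x$ under $G$, and $P_x=\{p_x : ((p_i),p)\in G_x\}\le S_m$. *)

theory Defs
  imports
    "HOL-Library.Multiset"
    "HOL-Library.FuncSet"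
    "HOL-Library.Infinite_Typeclass"
    "HOL-Combinatorics.Permutations"
    "HOL-Algebra.Generated_Groups"
    "HOL-Algebra.Group_Action"
begin

section \<open>Groupoid terms, identities and bracketings\<close>

datatype 'v gterm = Leaf 'v | Prod "'v gterm" "'v gterm"

primrec leaves :: "'v gterm \<Rightarrow> 'v list" where
  "leaves (Leaf v) = [v]"
| "leaves (Prod s t) = leaves s @ leaves t"

primrec subst :: "('v \<Rightarrow> 'w gterm) \<Rightarrow> 'v gterm \<Rightarrow> 'w gterm" where
  "subst \<sigma> (Leaf v) = \<sigma> v"
| "subst \<sigma> (Prod s t) = Prod (subst \<sigma> s) (subst \<sigma> t)"

primrec eval :: "('a \<Rightarrow> 'a \<Rightarrow> 'a) \<Rightarrow> ('v \<Rightarrow> 'a) \<Rightarrow> 'v gterm \<Rightarrow> 'a" where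
  "eval f \<rho> (Leaf v) = \<rho> v"
| "eval f \<rho> (Prod s t) = f (eval f \<rho> s) (eval f \<rho> t)"

type_synonym 'v identity = "'v gterm \<times> 'v gterm"

definition linear_identity :: "'v identity \<Rightarrow> bool" where
  "linear_identity \<phi> \<longleftrightarrow>
     distinct (leaves (fst \<phi>)) \<and> distinct (leaves (snd \<phi>)) \<and>
     set (leaves (fst \<phi>)) = set (leaves (snd \<phi>))"

text \<open>A bracketing is a term with its letters erased.\<close>

type_synonym bracketing = "unit gterm"

definition bracketing_of :: "'v gterm \<Rightarrow> bracketing" where
  "bracketing_of = map_gterm (\<lambda>_. ())"

definition bracketings :: "nat \<Rightarrow> bracketing set" where
  "bracketings m = {b. length (leaves b) = m}"


section \<open>Groupoids\<close>

text \<open>Groupoid is meant in the sense of magma: a set closed under one binary operation.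

  HOL cannot quantify over all types inside a formula. A statement about all groupoids is
  rendered by quantifying over all carriers \<open>C :: 'a set\<close>, where \<open>'a\<close> is an arbitrary
  infinite type. For a small finite \<open>'a\<close> the equivalence with a condition independent of \<open>'a\<close>
  would fail; no groupoid is lost, since one on a finite type is isomorphic to one
  carried by a finite subset of any infinite type.\<close>

definition groupoid :: "'a set \<Rightarrow> ('a \<Rightarrow> 'a \<Rightarrow> 'a) \<Rightarrow> bool" where
  "groupoid C f \<longleftrightarrow> (\<forall>x\<in>C. \<forall>y\<in>C. f x y \<in> C)"

definition satisfies :: "'a set \<Rightarrow> ('a \<Rightarrow> 'a \<Rightarrow> 'a) \<Rightarrow> 'v identity \<Rightarrow> bool" where
  "satisfies C f \<phi> \<longleftrightarrow>
     (\<forall>\<rho>. range \<rho> \<subseteq> C \<longrightarrow> eval f \<rho> (fst \<phi>) = eval f \<rho> (snd \<phi>))"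

text \<open>A bracketed product of elements of \<open>C\<close> is a term \<open>s\<close> whose leaves are these elements,
  in the order in which they are multiplied; its value is \<open>eval f id s\<close>.\<close>

definition AC_nice :: "nat \<Rightarrow> 'a set \<Rightarrow> ('a \<Rightarrow> 'a \<Rightarrow> 'a) \<Rightarrow> bool" where
  "AC_nice m C f \<longleftrightarrow>
     (\<forall>s t :: 'a gterm.
        set (leaves s) \<subseteq> C \<and> length (leaves s) = m \<and> mset (leaves s) = mset (leaves t)
        \<longrightarrow> eval f id s = eval f id t)"


section \<open>The identity-hedron\<close>

inductive apply_once :: "'v identity \<Rightarrow> 'w gterm \<Rightarrow> 'w gterm \<Rightarrow> bool" for \<phi> where
  forward:  "apply_once \<phi> (subst \<sigma> (fst \<phi>)) (subst \<sigma> (snd \<phi>))"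
| backward: "apply_once \<phi> (subst \<sigma> (snd \<phi>)) (subst \<sigma> (fst \<phi>))"
| left:     "apply_once \<phi> s s' \<Longrightarrow> apply_once \<phi> (Prod s t) (Prod s' t)"
| right:    "apply_once \<phi> t t' \<Longrightarrow> apply_once \<phi> (Prod s t) (Prod s t')"

text \<open>Positions are counted from \<open>0\<close>, and the letter in position \<open>p\<close> of the initial word is
  \<open>p\<close> itself. A triple \<open>(i, \<pi>, j)\<close> is an arrow from \<open>i\<close> to \<open>j\<close> labelled by \<open>\<pi>\<close>.\<close>

definition hedron_arrows :: "'v identity \<Rightarrow> nat \<Rightarrow> (bracketing \<times> (nat \<Rightarrow> nat) \<times> bracketing) set"
where
  "hedron_arrows \<phi> m =
     {(i, \<pi>, j). i \<in> bracketings m \<and> j \<in> bracketings m \<and> \<pi> permutes {..<m} \<and>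
        (\<exists>s t :: nat gterm.
           bracketing_of s = i \<and> leaves s = [0..<m] \<and> apply_once \<phi> s t \<and> bracketing_of t = j \<and>
           (\<forall>p<m. leaves t ! \<pi> p = leaves s ! p))}"


section \<open>Wreath product and the group of the identity-hedron\<close>

text \<open>Maps are written on the right in the source, so the product \<open>pq\<close> of two permutations
  applies \<open>p\<close> first; hence the order of composition below is opposite to that of
  \<open>sym_group\<close> in HOL-Algebra.\<close>

definition Sym :: "'x set \<Rightarrow> ('x \<Rightarrow> 'x) monoid" where
  "Sym S = \<lparr>carrier = {p. p permutes S}, mult = (\<lambda>p q. q \<circ> p), one = id\<rparr>"

definition wreath :: "('a, 'c) monoid_scheme \<Rightarrow> 'x set \<Rightarrow> (('x \<Rightarrow> 'a) \<times> ('x \<Rightarrow> 'x)) monoid" where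
  "wreath A X =
     \<lparr>carrier = (X \<rightarrow>\<^sub>E carrier A) \<times> carrier (Sym X),
      mult = (\<lambda>(a, p) (b, q). (\<lambda>i\<in>X. a i \<otimes>\<^bsub>A\<^esub> b (p i), p \<otimes>\<^bsub>Sym X\<^esub> q)),
      one = (\<lambda>i\<in>X. \<one>\<^bsub>A\<^esub>, \<one>\<^bsub>Sym X\<^esub>)\<rparr>"

abbreviation hedron_wreath :: "nat \<Rightarrow> ((bracketing \<Rightarrow> nat \<Rightarrow> nat) \<times> (bracketing \<Rightarrow> bracketing)) monoid"
where
  "hedron_wreath m \<equiv> wreath (Sym {..<m}) (bracketings m)"

text \<open>For a loop (\<open>i = j\<close>) the permutation component \<open>transpose i j\<close> is the identity, and the
  order of the case distinction makes the entry at \<open>i\<close> equal to \<open>\<pi>\<close>.\<close>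

definition arrow_element ::
  "nat \<Rightarrow> bracketing \<times> (nat \<Rightarrow> nat) \<times> bracketing
     \<Rightarrow> (bracketing \<Rightarrow> nat \<Rightarrow> nat) \<times> (bracketing \<Rightarrow> bracketing)" where
  "arrow_element m = (\<lambda>(i, \<pi>, j).
     (\<lambda>r\<in>bracketings m.
        if r = i then \<pi>
        else if r = j then inv\<^bsub>Sym {..<m}\<^esub> \<pi>
        else \<one>\<^bsub>Sym {..<m}\<^esub>,
      transpose i j))"

definition hedron_group ::
  "'v identity \<Rightarrow> nat \<Rightarrow> ((bracketing \<Rightarrow> nat \<Rightarrow> nat) \<times> (bracketing \<Rightarrow> bracketing)) monoid" where
  "hedron_group \<phi> m =
     (hedron_wreath m)
       \<lparr>carrier := generate (hedron_wreath m) (arrow_element m ` hedron_arrows \<phi> m)\<rparr>"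

text \<open>An element \<open>((p\<^sub>i), p)\<close> acts on bracketings through \<open>snd\<close>, i.e. as \<open>p\<close>. This is a right
  action; orbits and stabilizers do not depend on the side.\<close>

definition point_perms :: "'v identity \<Rightarrow> nat \<Rightarrow> bracketing \<Rightarrow> (nat \<Rightarrow> nat) set" where
  "point_perms \<phi> m x = {fst g x | g. g \<in> stabilizer (hedron_group \<phi> m) snd x}"

end

theory Submission
  imports Defs "HOL-Library.Nat_Bijection"
begin

text \<open>
  An element \<open>((p\<^sub>i), p)\<close> of the wreath product acts on the terms with \<open>m\<close> leaves: a term bracketed
  according to \<open>i\<close> becomes a term bracketed according to \<open>ip\<close>, its letters being permuted by \<open>p\<^sub>i\<close>.
  Under this action the orbits of \<open>W(\<phi>,m)\<close> on the terms in distinct letters are the classes of terms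
  that are equal modulo \<open>\<phi>\<close>. Transitivity of this action amounts to \<open>O\<^sub>x = X\<close> and \<open>P\<^sub>x = S\<^sub>m\<close>, and
  it amounts to \<open>m\<close>AC-niceness by completeness of equational logic, i.e. because equality
  in the relatively free groupoid of countable rank is equality modulo \<open>\<phi>\<close>.
\<close>

section \<open>Terms\<close>

lemma bracketing_of_simps [simp]:
  "bracketing_of (Leaf v) = Leaf ()"
  "bracketing_of (Prod s t) = Prod (bracketing_of s) (bracketing_of t)"
  by (simp_all add: bracketing_of_def)

lemma bracketing_of_map [simp]: "bracketing_of (map_gterm f t) = bracketing_of t"
  by (induction t) auto

lemma length_leaves_bracketing_of [simp]: "length (leaves (bracketing_of t)) = length (leaves t)"
  by (induction t) auto

lemma leaves_map [simp]: "leaves (map_gterm f t) = map f (leaves t)"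
  by (induction t) auto

lemma leaves_nonempty [simp]: "leaves t \<noteq> []"
  by (induction t) auto

lemma bracketing_of_in_bracketings: "bracketing_of t \<in> bracketings m \<longleftrightarrow> length (leaves t) = m"
  by (simp add: bracketings_def)

text \<open>Together with \<open>term_eqI\<close> this identifies a term with a bracketing and a
  word of matching length; elements of the wreath product act on such pairs.\<close>

lemma term_exists:
  assumes "length l = length (leaves b)"
  obtains t where "bracketing_of t = b" "leaves t = l"
proof -
  have "\<exists>t. bracketing_of t = b \<and> leaves t = l"
    using assms
  proof (induction b arbitrary: l)
    case (Leaf u)
    then obtain v where "l = [v]" by (auto simp: length_Suc_conv)
    then show ?case by (intro exI[of _ "Leaf v"]) auto
  next
    case (Prod b c)
    obtain s where "bracketing_of s = b" "leaves s = take (length (leaves b)) l"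
      using Prod.IH(1)[of "take (length (leaves b)) l"] Prod.prems by auto
    moreover obtain t where "bracketing_of t = c" "leaves t = drop (length (leaves b)) l"
      using Prod.IH(2)[of "drop (length (leaves b)) l"] Prod.prems by auto
    ultimately show ?case by (intro exI[of _ "Prod s t"]) auto
  qed
  with that show thesis by blast
qed

lemma term_eqI:
  assumes "bracketing_of s = bracketing_of t" "leaves s = leaves t"
  shows "s = t"
  using assms
proof (induction s arbitrary: t)
  case (Leaf v)
  then show ?case by (cases t) auto
next
  case (Prod s1 s2)
  then obtain t1 t2 where t: "t = Prod t1 t2" by (cases t) auto
  with Prod.prems have b: "bracketing_of s1 = bracketing_of t1" "bracketing_of s2 = bracketing_of t2"
    by auto
  \<comment> \<open>Equal lengths of the first factors allow the equation between concatenated words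
    to be split.\<close>
  then have "length (leaves s1) = length (leaves t1)"
    by (metis length_leaves_bracketing_of)
  with Prod b t show ?case by auto
qed

lemma bracketing_exists: "\<exists>b. length (leaves b) = Suc n"
proof (induction n)
  case 0
  then show ?case by (intro exI[of _ "Leaf undefined"]) auto
next
  case (Suc n)
  then obtain b :: "'a gterm" where "length (leaves b) = Suc n" by blast
  then show ?case by (intro exI[of _ "Prod b (Leaf undefined)"]) auto
qed

lemma map_subst: "map_gterm f (subst \<sigma> u) = subst (\<lambda>v. map_gterm f (\<sigma> v)) u"
  by (induction u) auto

lemma eval_subst: "eval f \<rho> (subst \<sigma> u) = eval f (\<lambda>v. eval f \<rho> (\<sigma> v)) u"
  by (induction u) auto

lemma eval_map: "eval f \<rho> (map_gterm h u) = eval f (\<lambda>v. \<rho> (h v)) u"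
  by (induction u) auto

lemma eval_cong: "(\<And>v. v \<in> set (leaves u) \<Longrightarrow> \<rho> v = \<rho>' v) \<Longrightarrow> eval f \<rho> u = eval f \<rho>' u"
  by (induction u) auto

lemma eval_closed: "groupoid C f \<Longrightarrow> \<rho> ` set (leaves u) \<subseteq> C \<Longrightarrow> eval f \<rho> u \<in> C"
  by (induction u) (auto simp: groupoid_def)

lemma mset_leaves_subst:
  "mset (leaves (subst \<sigma> u)) = (\<Sum>v\<in>#mset (leaves u). mset (leaves (\<sigma> v)))"
  by (induction u) auto


section \<open>Derivability\<close>

lemma apply_once_sym: "apply_once \<phi> s t \<Longrightarrow> apply_once \<phi> t s"
  by (induction rule: apply_once.induct) (auto intro: apply_once.intros)

lemma apply_once_map: "apply_once \<phi> s t \<Longrightarrow> apply_once \<phi> (map_gterm f s) (map_gterm f t)"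
  by (induction rule: apply_once.induct) (auto intro: apply_once.intros simp: map_subst)

text \<open>By linearity both sides of \<phi> have the same variables once each, so instances of the
  two sides contain the letters of every \<open>\<sigma> v\<close> equally often.\<close>

lemma apply_once_mset_leaves:
  assumes "linear_identity \<phi>" and "apply_once \<phi> s t"
  shows "mset (leaves s) = mset (leaves t)"
proof -
  have "mset (leaves (fst \<phi>)) = mset (leaves (snd \<phi>))"
    using assms(1) by (auto simp: linear_identity_def set_eq_iff_mset_eq_distinct)
  with assms(2) show ?thesis
    by (induction rule: apply_once.induct) (auto simp: mset_leaves_subst)
qed

text \<open>Equality modulo \<phi>. Since a single application can be reversed, the reflexive
  transitive closure is already an equivalence relation.\<close>

abbreviation derivable :: "'v identity \<Rightarrow> 'w gterm \<Rightarrow> 'w gterm \<Rightarrow> bool" where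
  "derivable \<phi> \<equiv> (apply_once \<phi>)\<^sup>*\<^sup>*"

lemma derivable_sym: "derivable \<phi> s t \<Longrightarrow> derivable \<phi> t s"
  by (metis apply_once_sym sympI sympD symp_rtranclp)

lemma derivable_Prod:
  assumes "derivable \<phi> s s'" "derivable \<phi> t t'"
  shows "derivable \<phi> (Prod s t) (Prod s' t')"
proof -
  have "derivable \<phi> (Prod s t) (Prod s' t)"
    using assms(1) by induction (auto intro: rtranclp.rtrancl_into_rtrancl apply_once.left)
  moreover have "derivable \<phi> (Prod s' t) (Prod s' t')"
    using assms(2) by induction (auto intro: rtranclp.rtrancl_into_rtrancl apply_once.right)
  ultimately show ?thesis by simp
qed

lemma derivable_mset_leaves:
  assumes "linear_identity \<phi>" and "derivable \<phi> s t"
  shows "mset (leaves s) = mset (leaves t)"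
  using assms(2) by induction (auto dest: apply_once_mset_leaves[OF assms(1)])

section \<open>Soundness of equational logic\<close>

lemma satisfies_eval_eq:
  assumes lin: "linear_identity \<phi>" and sat: "satisfies C f \<phi>"
    and \<rho>: "\<And>v. v \<in> set (leaves (fst \<phi>)) \<Longrightarrow> \<rho> v \<in> C"
  shows "eval f \<rho> (fst \<phi>) = eval f \<rho> (snd \<phi>)"
proof -
  obtain v where v: "v \<in> set (leaves (fst \<phi>))"
    using leaves_nonempty[of "fst \<phi>"] by (metis list.set_sel(1))
  \<comment> \<open>\<open>satisfies\<close> speaks only of assignments with all values in
    \<open>C\<close>, so variables not occurring in \<phi> are redirected to the value of an
    occurring one.\<close>
  define \<rho>' where "\<rho>' w = (if w \<in> set (leaves (fst \<phi>)) then \<rho> w else \<rho> v)" for w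
  have "range \<rho>' \<subseteq> C" using \<rho> v by (auto simp: \<rho>'_def)
  then have "eval f \<rho>' (fst \<phi>) = eval f \<rho>' (snd \<phi>)" using sat by (simp add: satisfies_def)
  moreover have "eval f \<rho>' (fst \<phi>) = eval f \<rho> (fst \<phi>)" "eval f \<rho>' (snd \<phi>) = eval f \<rho> (snd \<phi>)"
    using lin by (auto intro!: eval_cong simp: \<rho>'_def linear_identity_def)
  ultimately show ?thesis by simp
qed

lemma leaves_subst: "set (leaves (subst \<sigma> u)) = (\<Union>v\<in>set (leaves u). set (leaves (\<sigma> v)))"
  by (induction u) auto

lemma apply_once_eval_eq:
  assumes lin: "linear_identity \<phi>" and gr: "groupoid C f" and sat: "satisfies C f \<phi>"
    and "apply_once \<phi> s t" and "\<rho> ` set (leaves s) \<subseteq> C"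
  shows "eval f \<rho> s = eval f \<rho> t"
proof -
  have *: "eval f \<rho> (subst \<sigma> (fst \<phi>)) = eval f \<rho> (subst \<sigma> (snd \<phi>))"
    if "\<rho> ` set (leaves (subst \<sigma> (fst \<phi>))) \<subseteq> C" for \<sigma>
    unfolding eval_subst
    using that by (intro satisfies_eval_eq[OF lin sat] eval_closed[OF gr]) (auto simp: leaves_subst)
  from assms(4,5) show ?thesis
  proof induction
    case (backward \<sigma>)
    \<comment> \<open>\<open>*\<close> asks for the letters of the instance of
      \<open>fst \<phi>\<close>; by linearity they are those of the instance of
      \<open>snd \<phi>\<close>.\<close>
    moreover have "set (leaves (subst \<sigma> (snd \<phi>))) = set (leaves (subst \<sigma> (fst \<phi>)))"
      using lin by (auto simp: leaves_subst linear_identity_def)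
    ultimately show ?case using * by simp
  qed (use * in \<open>auto simp: image_Un\<close>)
qed

lemma derivable_eval_eq:
  assumes lin: "linear_identity \<phi>" and gr: "groupoid C f" and sat: "satisfies C f \<phi>"
    and "derivable \<phi> s t" and "\<rho> ` set (leaves s) \<subseteq> C"
  shows "eval f \<rho> s = eval f \<rho> t"
  using assms(4)
proof induction
  case (step t u)
  have "set (leaves s) = set (leaves t)"
    using derivable_mset_leaves[OF lin step(1)] by (metis set_mset_mset)
  with step assms(5) show ?case
    using apply_once_eval_eq[OF lin gr sat] by metis
qed simp


section \<open>Completeness of equational logic\<close>

text \<open>An arbitrary infinite type guarantees an injection from the naturals, so terms are coded
  by numbers before being transferred to that type.\<close>

primrec encode_gterm :: "nat gterm \<Rightarrow> nat" where
  "encode_gterm (Leaf n) = sum_encode (Inl n)"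
| "encode_gterm (Prod s t) = sum_encode (Inr (prod_encode (encode_gterm s, encode_gterm t)))"

lemma inj_encode_gterm: "inj encode_gterm"
proof (rule injI)
  fix s t assume "encode_gterm s = encode_gterm t"
  then show "s = t"
  proof (induction s arbitrary: t)
    case (Leaf n)
    then show ?case by (cases t) (auto simp: sum_encode_eq prod_encode_eq)
  next
    case (Prod s1 s2)
    then show ?case by (cases t) (auto simp: sum_encode_eq prod_encode_eq)
  qed
qed

text \<open>The relatively free groupoid on \<open>\<nat>\<close> is realised on encodings of chosen representatives
  of the classes of derivably equal terms.\<close>

lemma free_groupoid_exists:
  fixes \<phi> :: "'v identity"
  obtains C :: "'a::infinite set" and f \<rho> where
    "groupoid C f" "satisfies C f \<phi>" "range \<rho> \<subseteq> C"
    "\<And>s t :: nat gterm. eval f \<rho> s = eval f \<rho> t \<Longrightarrow> derivable \<phi> s t"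
proof -
  obtain h :: "nat \<Rightarrow> 'a" where "inj h"
    using infinite_countable_subset[OF infinite_UNIV] by blast
  define enc where "enc = h \<circ> encode_gterm"
  have enc: "inj enc" unfolding enc_def using \<open>inj h\<close> inj_encode_gterm by (rule inj_compose)
  define dec where "dec = Hilbert_Choice.inv enc"
  have dec [simp]: "dec (enc t) = t" for t by (simp add: dec_def enc)
  define rep where "rep t = (SOME s. derivable \<phi> t s)" for t :: "nat gterm"
  have rep: "derivable \<phi> t (rep t)" for t
    unfolding rep_def by (rule someI[of _ t]) simp
  have rep_eq: "rep s = rep t" if "derivable \<phi> s t" for s t
  proof -
    \<comment> \<open>Both terms have the same class as a predicate, hence \<open>SOME\<close> picks
      the same representative.\<close>
    have "derivable \<phi> s = derivable \<phi> t"
      using that derivable_sym[OF that] by (auto intro!: ext intro: rtranclp_trans)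
    then show ?thesis by (simp add: rep_def)
  qed
  have rep_rep [simp]: "rep (rep t) = rep t" for t
    using rep_eq[OF rep[of t]] by simp
  define C where "C = range (\<lambda>t. enc (rep t))"
  define f where "f a b = enc (rep (Prod (dec a) (dec b)))" for a b
  define \<rho> where "\<rho> n = enc (rep (Leaf n))" for n
  \<comment> \<open>Derivability is compatible with products, which makes \<open>f\<close> well
    defined on classes.\<close>
  have f_rep: "f (enc (rep s)) (enc (rep t)) = enc (rep (Prod s t))" for s t
    unfolding f_def by (simp, rule arg_cong[of _ _ enc], rule rep_eq,
      rule derivable_Prod) (use rep derivable_sym in blast)+
  show thesis
  proof
    show "groupoid C f" by (auto simp: groupoid_def C_def f_def)
    show "range \<rho> \<subseteq> C" by (auto simp: \<rho>_def C_def)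
    show "satisfies C f \<phi>" unfolding satisfies_def
    proof (intro allI impI)
      fix \<tau> :: "'v \<Rightarrow> 'a" assume \<tau>: "range \<tau> \<subseteq> C"
      \<comment> \<open>Evaluation here amounts to substituting representatives, so the two sides of
        \<phi> evaluate to the classes of terms that differ by a single application of
        \<phi>.\<close>
      have "eval f \<tau> u = enc (rep (subst (\<lambda>v. dec (\<tau> v)) u))" for u
      proof (induction u)
        case (Leaf v)
        have "\<tau> v \<in> C" using \<tau> by auto
        then show ?case by (auto simp: C_def)
      qed (simp add: f_rep)
      moreover have "rep (subst (\<lambda>v. dec (\<tau> v)) (fst \<phi>)) = rep (subst (\<lambda>v. dec (\<tau> v)) (snd \<phi>))"
        by (intro rep_eq r_into_rtranclp apply_once.forward)
      ultimately show "eval f \<tau> (fst \<phi>) = eval f \<tau> (snd \<phi>)" by simp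
    qed
    fix s t :: "nat gterm"
    have *: "eval f \<rho> u = enc (rep u)" for u
      by (induction u) (auto simp: \<rho>_def f_rep)
    assume "eval f \<rho> s = eval f \<rho> t"
    then have "rep s = rep t" using enc by (simp add: * inj_eq)
    then show "derivable \<phi> s t"
      by (metis rep derivable_sym rtranclp_trans)
  qed
qed

text \<open>One groupoid suffices as a test: the letters are renamed to generators of the relatively
  free groupoid, where AC-niceness equates the two products and equality implies
  derivability.\<close>

lemma all_AC_nice_imp_derivable:
  fixes \<phi> :: "'v identity" and s t :: "nat gterm"
  assumes "\<forall>(C :: 'a::infinite set) f. groupoid C f \<and> satisfies C f \<phi> \<longrightarrow> AC_nice m C f"
    and "length (leaves s) = m" and "mset (leaves s) = mset (leaves t)"
  shows "derivable \<phi> s t"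
proof -
  obtain C :: "'a set" and f \<rho> where C: "groupoid C f" "satisfies C f \<phi>" "range \<rho> \<subseteq> C"
    and der: "\<And>s t :: nat gterm. eval f \<rho> s = eval f \<rho> t \<Longrightarrow> derivable \<phi> s t"
    using free_groupoid_exists by metis
  have "AC_nice m C f" using assms(1) C by blast
  then have "eval f id (map_gterm \<rho> s) = eval f id (map_gterm \<rho> t)"
    using assms(2,3) C(3) unfolding AC_nice_def
    by (elim allE[of _ "map_gterm \<rho> s"] allE[of _ "map_gterm \<rho> t"]) auto
  then show ?thesis by (intro der) (simp add: eval_map)
qed


section \<open>The wreath product\<close>

lemma Sym_simps [simp]:
  "carrier (Sym S) = {p. p permutes S}" "p \<otimes>\<^bsub>Sym S\<^esub> q = q \<circ> p" "\<one>\<^bsub>Sym S\<^esub> = id"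
  by (simp_all add: Sym_def)

lemma group_Sym: "group (Sym S)"
proof (rule groupI)
  fix p assume "p \<in> carrier (Sym S)"
  then show "\<exists>q\<in>carrier (Sym S). q \<otimes>\<^bsub>Sym S\<^esub> p = \<one>\<^bsub>Sym S\<^esub>"
    by (intro bexI[of _ "Hilbert_Choice.inv p"]) (auto simp: permutes_inv permutes_inv_o)
qed (auto simp: permutes_compose permutes_id o_assoc)

lemma wreath_simps:
  "carrier (wreath A X) = (X \<rightarrow>\<^sub>E carrier A) \<times> {p. p permutes X}"
  "g \<otimes>\<^bsub>wreath A X\<^esub> h = (\<lambda>i\<in>X. fst g i \<otimes>\<^bsub>A\<^esub> fst h (snd g i), snd h \<circ> snd g)"
  "\<one>\<^bsub>wreath A X\<^esub> = (\<lambda>i\<in>X. \<one>\<^bsub>A\<^esub>, id)"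
  by (auto simp: wreath_def split: prod.splits)

lemma group_wreath:
  assumes "group A"
  shows "group (wreath A X)"
proof (rule groupI)
  interpret A: group A by fact
  show "x \<otimes>\<^bsub>wreath A X\<^esub> y \<in> carrier (wreath A X)"
    if "x \<in> carrier (wreath A X)" "y \<in> carrier (wreath A X)" for x y
    using that by (auto simp: wreath_simps permutes_compose permutes_in_image intro!: A.m_closed)
  show "\<one>\<^bsub>wreath A X\<^esub> \<in> carrier (wreath A X)"
    by (auto simp: wreath_simps permutes_id)
  show "x \<otimes>\<^bsub>wreath A X\<^esub> y \<otimes>\<^bsub>wreath A X\<^esub> z = x \<otimes>\<^bsub>wreath A X\<^esub> (y \<otimes>\<^bsub>wreath A X\<^esub> z)"
    if "x \<in> carrier (wreath A X)" "y \<in> carrier (wreath A X)" "z \<in> carrier (wreath A X)" for x y z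
    using that by (auto simp: wreath_simps permutes_in_image o_assoc PiE_iff
        intro!: A.m_assoc restrict_ext)
  show "\<one>\<^bsub>wreath A X\<^esub> \<otimes>\<^bsub>wreath A X\<^esub> x = x" if "x \<in> carrier (wreath A X)" for x
    using that by (auto simp: wreath_simps PiE_iff extensional_def fun_eq_iff prod_eq_iff)
  show "\<exists>y\<in>carrier (wreath A X). y \<otimes>\<^bsub>wreath A X\<^esub> x = \<one>\<^bsub>wreath A X\<^esub>"
    if "x \<in> carrier (wreath A X)" for x
  proof (intro bexI)
    \<comment> \<open>Multiplication shifts the index by the permutation of the first factor; hence
      the entry of the inverse at \<open>i\<close> inverts the entry of \<open>x\<close> at the
      preimage of \<open>i\<close>.\<close>
    let ?y = "(\<lambda>i\<in>X. inv\<^bsub>A\<^esub> (fst x (Hilbert_Choice.inv (snd x) i)), Hilbert_Choice.inv (snd x))"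
    have p: "snd x permutes X" and a: "\<And>i. i \<in> X \<Longrightarrow> fst x i \<in> carrier A"
      using that by (auto simp: wreath_simps)
    have p': "Hilbert_Choice.inv (snd x) i \<in> X" if "i \<in> X" for i
      using p that by (simp add: permutes_in_image permutes_inv)
    show "?y \<otimes>\<^bsub>wreath A X\<^esub> x = \<one>\<^bsub>wreath A X\<^esub>"
      using p by (auto simp: wreath_simps permutes_inv_o intro!: restrict_ext A.l_inv a p')
    show "?y \<in> carrier (wreath A X)"
      using p by (auto simp: wreath_simps permutes_inv intro!: A.inv_closed a p')
  qed
qed


section \<open>The action of the wreath product on terms\<close>

text \<open>The graph of the action of \<open>g\<close>, with the convention of arrow labels: the
  entry of \<open>g\<close> at the bracketing of \<open>s\<close> tells the new position of each
  letter. A relation simply excludes the terms \<open>s\<close> that do not have \<open>m\<close>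
  leaves.\<close>

definition moves ::
  "nat \<Rightarrow> (bracketing \<Rightarrow> nat \<Rightarrow> nat) \<times> (bracketing \<Rightarrow> bracketing) \<Rightarrow> 'w gterm \<Rightarrow> 'w gterm \<Rightarrow> bool"
where
  "moves m g s t \<longleftrightarrow>
     bracketing_of s \<in> bracketings m \<and> bracketing_of t = snd g (bracketing_of s) \<and>
     (\<forall>q<m. leaves t ! fst g (bracketing_of s) q = leaves s ! q)"

lemma hedron_wreath_fst:
  "g \<in> carrier (hedron_wreath m) \<Longrightarrow> i \<in> bracketings m \<Longrightarrow> fst g i permutes {..<m}"
  by (auto simp: wreath_simps)

lemma hedron_wreath_snd: "g \<in> carrier (hedron_wreath m) \<Longrightarrow> snd g permutes bracketings m"
  by (auto simp: wreath_simps)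

lemma moves_bracketings:
  assumes "g \<in> carrier (hedron_wreath m)" "moves m g s t"
  shows "bracketing_of t \<in> bracketings m"
  using assms by (simp add: moves_def permutes_in_image[OF hedron_wreath_snd])

text \<open>\<open>permute_list p xs\<close> reads \<open>xs\<close> at the positions
  \<open>p q\<close>, so it pulls the word of the target back to that of the source. This form
  connects the action with multisets.\<close>

lemma moves_iff_permute_list:
  assumes g: "g \<in> carrier (hedron_wreath m)"
  shows "moves m g s t \<longleftrightarrow> bracketing_of s \<in> bracketings m \<and>
    bracketing_of t = snd g (bracketing_of s) \<and>
    permute_list (fst g (bracketing_of s)) (leaves t) = leaves s"
    (is "?L \<longleftrightarrow> ?R")
proof (cases "bracketing_of s \<in> bracketings m \<and> bracketing_of t = snd g (bracketing_of s)")
  case True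
  then have "bracketing_of t \<in> bracketings m"
    using g by (simp add: permutes_in_image[OF hedron_wreath_snd])
  with True have "length (leaves t) = m" "length (leaves s) = m"
    by (metis bracketing_of_in_bracketings)+
  with True show ?thesis
    using permute_list_nth[of "fst g (bracketing_of s)" "leaves t"] hedron_wreath_fst[OF g]
    by (auto simp: moves_def list_eq_iff_nth_eq)
qed (auto simp: moves_def)

lemma moves_mset_leaves:
  assumes "g \<in> carrier (hedron_wreath m)" "moves m g s t"
  shows "mset (leaves s) = mset (leaves t)"
proof -
  have "length (leaves t) = m"
    using moves_bracketings[OF assms] by (simp add: bracketing_of_in_bracketings)
  moreover have "bracketing_of s \<in> bracketings m"
    "permute_list (fst g (bracketing_of s)) (leaves t) = leaves s"
    using assms by (simp_all add: moves_iff_permute_list)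
  ultimately show ?thesis
    using hedron_wreath_fst[OF assms(1)] by (metis mset_permute_list)
qed

text \<open>Letters are pushed forward along the entry of \<open>g\<close>, so the target word reads
  the source word through the inverse permutation. With \<open>moves_unique\<close>,
  \<open>g\<close> acts as a function on the terms with \<open>m\<close> leaves.\<close>

lemma moves_exists:
  assumes g: "g \<in> carrier (hedron_wreath m)" and s: "bracketing_of s \<in> bracketings m"
  obtains t where "moves m g s t"
proof -
  let ?p = "fst g (bracketing_of s)"
  have p: "?p permutes {..<m}" using g s by (rule hedron_wreath_fst)
  have len: "length (leaves s) = m" using s by (simp add: bracketing_of_in_bracketings)
  have "snd g (bracketing_of s) \<in> bracketings m"
    using s by (simp add: permutes_in_image[OF hedron_wreath_snd[OF g]])
  then obtain t where t: "bracketing_of t = snd g (bracketing_of s)"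
      "leaves t = permute_list (Hilbert_Choice.inv ?p) (leaves s)"
    using term_exists[of "permute_list (Hilbert_Choice.inv ?p) (leaves s)" "snd g (bracketing_of s)"] len
    by (auto simp: bracketings_def)
  have "leaves t ! ?p q = leaves s ! q" if "q < m" for q
  proof -
    have "?p q < m" using permutes_in_image[OF p] that by auto
    then have "leaves t ! ?p q = leaves s ! Hilbert_Choice.inv ?p (?p q)"
      unfolding t using len permutes_inv[OF p] by (intro permute_list_nth) auto
    then show ?thesis by (simp add: permutes_inverses[OF p])
  qed
  with t(1) s have "moves m g s t" by (simp add: moves_def)
  then show thesis by (rule that)
qed

lemma moves_unique:
  assumes g: "g \<in> carrier (hedron_wreath m)" and "moves m g s t" "moves m g s u"
  shows "t = u"
proof (rule term_eqI)
  let ?p = "fst g (bracketing_of s)"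
  have s: "bracketing_of s \<in> bracketings m" using assms by (simp add: moves_def)
  have p: "?p permutes {..<m}" using g s by (rule hedron_wreath_fst)
  show "bracketing_of t = bracketing_of u" using assms by (simp add: moves_def)
  have len: "length (leaves t) = m" "length (leaves u) = m"
    using moves_bracketings[OF g] assms(2,3) by (auto simp: bracketing_of_in_bracketings)
  show "leaves t = leaves u"
  proof (rule nth_equalityI)
    fix q assume "q < length (leaves t)"
    then have "q \<in> ?p ` {..<m}" using len by (simp add: permutes_image[OF p])
    then show "leaves t ! q = leaves u ! q" using assms(2,3) by (auto simp: moves_def)
  qed (simp add: len)
qed

lemma moves_one: "bracketing_of s \<in> bracketings m \<Longrightarrow> moves m \<one>\<^bsub>hedron_wreath m\<^esub> s s"
  by (simp add: moves_def wreath_simps)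

lemma moves_one_iff:
  "moves m \<one>\<^bsub>hedron_wreath m\<^esub> s t \<longleftrightarrow> bracketing_of s \<in> bracketings m \<and> s = t"
  using moves_one[of s m] moves_unique[of "\<one>\<^bsub>hedron_wreath m\<^esub>" m s s t]
    group.is_monoid[OF group_wreath[OF group_Sym]]
  by (metis monoid.one_closed moves_def)

text \<open>After \<open>g\<close> the term has a new bracketing, and \<open>h\<close> contributes
  its entry there; this is the index shift in the wreath multiplication.\<close>

lemma moves_mult:
  assumes g: "g \<in> carrier (hedron_wreath m)" and gst: "moves m g s t" and htu: "moves m h t u"
  shows "moves m (g \<otimes>\<^bsub>hedron_wreath m\<^esub> h) s u"
proof -
  have s: "bracketing_of s \<in> bracketings m" using gst by (simp add: moves_def)
  have "fst g (bracketing_of s) q < m" if "q < m" for q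
    using permutes_in_image[OF hedron_wreath_fst[OF g s], of q] that by simp
  with s gst htu show ?thesis by (auto simp: moves_def wreath_simps)
qed

text \<open>If \<open>g\<close> moves \<open>t\<close> to \<open>u\<close>, then the inverse
  followed by \<open>g\<close> is the identity and moves \<open>s\<close> to \<open>u\<close>, so
  \<open>u = s\<close>.\<close>

lemma moves_inv:
  assumes g: "g \<in> carrier (hedron_wreath m)" and gst: "moves m (inv\<^bsub>hedron_wreath m\<^esub> g) s t"
  shows "moves m g t s"
proof -
  interpret W: group "hedron_wreath m" by (intro group_wreath group_Sym)
  have g': "inv\<^bsub>hedron_wreath m\<^esub> g \<in> carrier (hedron_wreath m)" using g by simp
  obtain u where u: "moves m g t u" using moves_exists[OF g moves_bracketings[OF g' gst]] .
  have "moves m \<one>\<^bsub>hedron_wreath m\<^esub> s u"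
    using moves_mult[OF g' gst u] g by simp
  with u show ?thesis by (simp add: moves_one_iff)
qed


section \<open>Orbits of the group of the identity-hedron\<close>

lemma inv_Sym: "p permutes S \<Longrightarrow> inv\<^bsub>Sym S\<^esub> p = Hilbert_Choice.inv p"
  using group.inv_equality[OF group_Sym, where y = "Hilbert_Choice.inv p" and x = p]
  by (simp add: permutes_inv permutes_inv_o)

lemma arrow_element_closed:
  assumes "r \<in> hedron_arrows \<phi> m"
  shows "arrow_element m r \<in> carrier (hedron_wreath m)"
  using assms
  by (auto simp: hedron_arrows_def arrow_element_def wreath_simps inv_Sym permutes_inv permutes_id
      intro: permutes_swap_id)

text \<open>The element of an arrow acts along the arrow at its source, backwards at a different
  target, and trivially elsewhere.\<close>

lemma arrow_moves_derivable:
  assumes r: "r \<in> hedron_arrows \<phi> m" and mv: "moves m (arrow_element m r) s t"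
  shows "derivable \<phi> s t"
proof -
  obtain i \<pi> j where r_eq: "r = (i, \<pi>, j)" by (cases r)
  obtain u v :: "nat gterm" where
    i: "i \<in> bracketings m" and j: "j \<in> bracketings m" and \<pi>: "\<pi> permutes {..<m}" and
    u: "bracketing_of u = i" "leaves u = [0..<m]" and uv: "apply_once \<phi> u v"
    and v: "bracketing_of v = j" "\<forall>p<m. leaves v ! \<pi> p = leaves u ! p"
    using r by (auto simp: r_eq hedron_arrows_def)
  let ?g = "arrow_element m r"
  have g: "?g \<in> carrier (hedron_wreath m)" using r by (rule arrow_element_closed)
  \<comment> \<open>The arrow is witnessed by terms in the letters below \<open>m\<close> only;
    renaming \<open>p\<close> to the letter of \<open>x\<close> in position \<open>p\<close> turns
    the witnesses into \<open>x\<close> and \<open>y\<close>.\<close>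
  have forward: "apply_once \<phi> x y"
    if x: "bracketing_of x = i" and y: "bracketing_of y = j"
      and xy: "\<forall>p<m. leaves y ! \<pi> p = leaves x ! p" for x y :: "'b gterm"
  proof -
    have len: "length (leaves x) = m" "length (leaves y) = m" "length (leaves v) = m"
      using i j x y v(1) by (metis bracketing_of_in_bracketings)+
    have "x = map_gterm ((!) (leaves x)) u"
      using x u map_nth[of "leaves x"] len(1) by (intro term_eqI[of x "map_gterm _ u"]) simp_all
    moreover have "y = map_gterm ((!) (leaves x)) v"
    proof (rule term_eqI)
      show "leaves y = leaves (map_gterm ((!) (leaves x)) v)"
      proof (rule nth_equalityI)
        fix q assume "q < length (leaves y)"
        then have "q \<in> \<pi> ` {..<m}" using len by (simp add: permutes_image[OF \<pi>])
        then obtain p where "p < m" "q = \<pi> p" by auto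
        moreover have "\<pi> p < m" using permutes_in_image[OF \<pi>, of p] \<open>p < m\<close> by simp
        ultimately show "leaves y ! q = leaves (map_gterm ((!) (leaves x)) v) ! q"
          using xy v(2) u(2) len by simp
      qed (simp add: len)
    qed (simp add: y v)
    ultimately show ?thesis using apply_once_map[OF uv] by metis
  qed
  \<comment> \<open>Loops fall under the first case, in agreement with the order of the tests in
    \<open>arrow_element\<close>.\<close>
  consider (1) "bracketing_of s = i" | (2) "bracketing_of s = j" "i \<noteq> j"
    | (3) "bracketing_of s \<noteq> i" "bracketing_of s \<noteq> j"
    by blast
  then show ?thesis
  proof cases
    case 1
    then have "apply_once \<phi> s t"
      using mv i by (intro forward) (auto simp: moves_def r_eq arrow_element_def)
    then show ?thesis by blast
  next
    case 2
    have t: "bracketing_of t = i" and st: "\<And>q. q < m \<Longrightarrow> leaves t ! Hilbert_Choice.inv \<pi> q = leaves s ! q"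
      using mv j 2 by (auto simp: moves_def r_eq arrow_element_def inv_Sym[OF \<pi>])
    \<comment> \<open>The entry at \<open>j\<close> is the inverse of \<pi>, so the arrow leads from
      \<open>t\<close> back to \<open>s\<close>.\<close>
    have "leaves s ! \<pi> p = leaves t ! p" if "p < m" for p
      using st[of "\<pi> p"] permutes_in_image[OF \<pi>, of p] that by (simp add: permutes_inverses[OF \<pi>])
    then have "apply_once \<phi> t s" using 2 t by (intro forward) auto
    then show ?thesis by (blast intro: apply_once_sym)
  next
    case 3
    then have "moves m \<one>\<^bsub>hedron_wreath m\<^esub> s t"
      using mv by (auto simp: moves_def r_eq arrow_element_def wreath_simps transpose_def)
    then show ?thesis by (simp add: moves_one_iff)
  qed
qed

lemma hedron_group_carrier:
  "carrier (hedron_group \<phi> m) = generate (hedron_wreath m) (arrow_element m ` hedron_arrows \<phi> m)"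
  by (simp add: hedron_group_def)

lemma hedron_group_subset: "carrier (hedron_group \<phi> m) \<subseteq> carrier (hedron_wreath m)"
  unfolding hedron_group_carrier
  by (rule group.generate_incl[OF group_wreath[OF group_Sym]]) (auto intro: arrow_element_closed)

lemma hedron_group_moves_derivable:
  assumes "g \<in> carrier (hedron_group \<phi> m)" and "moves m g s t"
  shows "derivable \<phi> s t"
  using assms unfolding hedron_group_carrier
proof (induction g arbitrary: s t rule: generate.induct)
  case one
  then show ?case by (simp add: moves_one_iff)
next
  case (incl g)
  then show ?case by (auto intro: arrow_moves_derivable)
next
  case (inv g)
  then have "g \<in> carrier (hedron_wreath m)" by (auto intro: arrow_element_closed)
  then have "moves m g t s" using inv.prems by (rule moves_inv)
  with inv show ?case by (auto intro: arrow_moves_derivable derivable_sym)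
next
  case (eng g h)
  have g: "g \<in> carrier (hedron_wreath m)" and h: "h \<in> carrier (hedron_wreath m)"
    using eng(1,2) hedron_group_subset unfolding hedron_group_carrier by blast+
  have s: "bracketing_of s \<in> bracketings m" using eng.prems by (simp add: moves_def)
  \<comment> \<open>Acting by \<open>g\<close> and then by \<open>h\<close> supplies the
    intermediate term for the two induction hypotheses; uniqueness identifies the final term with
    \<open>t\<close>.\<close>
  obtain u where u: "moves m g s u" using moves_exists[OF g s] .
  obtain v where v: "moves m h u v" using moves_exists[OF h moves_bracketings[OF g u]] .
  interpret W: group "hedron_wreath m" by (intro group_wreath group_Sym)
  have "v = t"
    using moves_unique[OF _ moves_mult[OF g u v] eng.prems] g h by simp
  with eng.IH u v show ?case by (meson rtranclp_trans)
qed

section \<open>From derivations to elements of the group\<close>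

lemma apply_once_moves:
  assumes lin: "linear_identity \<phi>" and st: "apply_once \<phi> s t"
    and dist: "distinct (leaves s)" and len: "length (leaves s) = m"
  obtains g where "g \<in> arrow_element m ` hedron_arrows \<phi> m" "moves m g s t"
proof -
  have ms: "mset (leaves s) = mset (leaves t)" using lin st by (rule apply_once_mset_leaves)
  have len': "length (leaves t) = m" using ms len by (metis size_mset)
  obtain \<pi> where \<pi>: "\<pi> permutes {..<m}" and \<pi>_eq: "permute_list \<pi> (leaves t) = leaves s"
    using mset_eq_permutation[OF ms] len' by metis
  have \<pi>_nth: "leaves t ! \<pi> p = leaves s ! p" if "p < m" for p
    using permute_list_nth[of \<pi> "leaves t" p] \<pi> \<pi>_eq len' that by simp
  \<comment> \<open>Distinct letters can be renamed to their positions in \<open>s\<close>; the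
    renamed pair of terms witnesses an arrow labelled \<pi>.\<close>
  define f where "f = the_inv_into {..<m} ((!) (leaves s))"
  have inj: "inj_on ((!) (leaves s)) {..<m}"
    using dist len by (auto simp: inj_on_def nth_eq_iff_index_eq)
  have f: "f (leaves s ! p) = p" if "p < m" for p
    unfolding f_def using that by (intro the_inv_into_f_f[OF inj]) auto
  have "apply_once \<phi> (map_gterm f s) (map_gterm f t)" using st by (rule apply_once_map)
  moreover have "leaves (map_gterm f s) = [0..<m]"
    using f len by (auto intro!: nth_equalityI)
  moreover have "leaves (map_gterm f t) ! \<pi> p = leaves (map_gterm f s) ! p" if "p < m" for p
    using \<pi>_nth[OF that] permutes_in_image[OF \<pi>, of p] that len len' by simp
  ultimately have r: "(bracketing_of s, \<pi>, bracketing_of t) \<in> hedron_arrows \<phi> m"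
    unfolding hedron_arrows_def mem_Collect_eq case_prod_conv
    using \<pi> len len' by (intro conjI exI[of _ "map_gterm f s"] exI[of _ "map_gterm f t"])
      (simp_all add: bracketing_of_in_bracketings)
  have "moves m (arrow_element m (bracketing_of s, \<pi>, bracketing_of t)) s t"
    using \<pi>_nth len by (simp add: moves_def arrow_element_def bracketing_of_in_bracketings)
  with r that show thesis by blast
qed

text \<open>Each step contributes a generator, and linearity keeps the letters distinct and their
  number equal to \<open>m\<close> along the derivation.\<close>

lemma derivable_hedron_group_moves:
  assumes lin: "linear_identity \<phi>" and "derivable \<phi> s t"
    and dist: "distinct (leaves s)" and len: "length (leaves s) = m"
  obtains g where "g \<in> carrier (hedron_group \<phi> m)" "moves m g s t"
proof -
  from assms(2) have "\<exists>g\<in>carrier (hedron_group \<phi> m). moves m g s t"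
  proof induction
    case base
    show ?case unfolding hedron_group_carrier
      using len by (intro bexI[of _ "\<one>\<^bsub>hedron_wreath m\<^esub>"] moves_one generate.one)
        (simp add: bracketing_of_in_bracketings)
  next
    case (step t u)
    then obtain g where g: "g \<in> carrier (hedron_group \<phi> m)" "moves m g s t" by blast
    have "mset (leaves s) = mset (leaves t)" using lin step(1) by (rule derivable_mset_leaves)
    then have "distinct (leaves t)" "length (leaves t) = m"
      using dist len by (metis mset_eq_imp_distinct_iff, metis size_mset)
    then obtain h where h: "h \<in> arrow_element m ` hedron_arrows \<phi> m" "moves m h t u"
      using apply_once_moves[OF lin step(2)] by blast
    have "g \<otimes>\<^bsub>hedron_wreath m\<^esub> h \<in> carrier (hedron_group \<phi> m)"
      using g(1) h(1) unfolding hedron_group_carrier by (blast intro: generate.intros)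
    moreover have "moves m (g \<otimes>\<^bsub>hedron_wreath m\<^esub> h) s u"
      using g h hedron_group_subset by (blast intro: moves_mult)
    ultimately show ?case by blast
  qed
  with that show thesis by blast
qed

section \<open>Stabilizers, orbits and transitivity on terms\<close>

lemma point_perms_iff:
  "p \<in> point_perms \<phi> m x \<longleftrightarrow> (\<exists>g\<in>carrier (hedron_group \<phi> m). snd g x = x \<and> fst g x = p)"
  unfolding point_perms_def stabilizer_def by blast

lemma orbit_iff:
  "y \<in> orbit (hedron_group \<phi> m) snd x \<longleftrightarrow> (\<exists>g\<in>carrier (hedron_group \<phi> m). snd g x = y)"
  unfolding orbit_def by blast

theorem proposition6p2:
  fixes \<phi> :: "'v identity" and m :: nat
  assumes "linear_identity \<phi>" and "m > 0"
  shows "(\<forall>(C :: 'a::infinite set) f. groupoid C f \<and> satisfies C f \<phi> \<longrightarrow> AC_nice m C f) \<longleftrightarrow>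
    (\<exists>x \<in> bracketings m.
       point_perms \<phi> m x = carrier (Sym {..<m}) \<and>
       orbit (hedron_group \<phi> m) snd x = bracketings m)"
  (is "?nice \<longleftrightarrow> (\<exists>x \<in> bracketings m. ?full x)")
proof
  assume nice: ?nice
  \<comment> \<open>Any bracketing can serve as \<open>x\<close>; one exists because
    \<open>m\<close> is positive.\<close>
  obtain x :: bracketing where len_x: "length (leaves x) = m"
    using bracketing_exists[of "m - 1"] \<open>m > 0\<close> by auto
  then have x: "x \<in> bracketings m" by (simp add: bracketings_def)
  \<comment> \<open>One claim for both conditions: \<open>y = x\<close> gives the whole symmetric
    group, \<open>\<pi> = id\<close> gives the full orbit.\<close>
  have *: "\<exists>g\<in>carrier (hedron_group \<phi> m). snd g x = y \<and> fst g x = \<pi>"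
    if y: "y \<in> bracketings m" and \<pi>: "\<pi> permutes {..<m}" for y \<pi>
  proof -
    have len_y: "length (leaves y) = m" using y by (simp add: bracketings_def)
    obtain s where s: "bracketing_of s = x" "leaves s = [0..<m]"
      using term_exists[of "[0..<m]" x] len_x by auto
    \<comment> \<open>In \<open>t\<close> the letter \<open>q\<close> stands in position
      \<open>\<pi> q\<close>, so an element moving \<open>s\<close> to \<open>t\<close> must have
      the entry \<pi> at \<open>x\<close>.\<close>
    obtain t where t: "bracketing_of t = y" "leaves t = permute_list (Hilbert_Choice.inv \<pi>) [0..<m]"
      using term_exists[of "permute_list (Hilbert_Choice.inv \<pi>) [0..<m]" y] len_y by auto
    have \<pi>': "Hilbert_Choice.inv \<pi> permutes {..<m}" using \<pi> by (rule permutes_inv)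
    have "mset (leaves s) = mset (leaves t)"
      using mset_permute_list[of "Hilbert_Choice.inv \<pi>" "[0..<m]"] \<pi>' s t by simp
    with nice s have "derivable \<phi> s t" by (intro all_AC_nice_imp_derivable[of \<phi> m]) auto
    then obtain g where g: "g \<in> carrier (hedron_group \<phi> m)" and mv: "moves m g s t"
      using derivable_hedron_group_moves[OF assms(1)] s by (metis distinct_upt diff_zero length_upt)
    have p: "fst g x permutes {..<m}"
      using g hedron_group_subset x by (blast intro: hedron_wreath_fst)
    have "fst g x q = \<pi> q" if "q < m" for q
    proof -
      have "fst g x q < m" using permutes_in_image[OF p, of q] that by simp
      then have "leaves t ! fst g x q = Hilbert_Choice.inv \<pi> (fst g x q)"
        unfolding t using permute_list_nth[of "Hilbert_Choice.inv \<pi>" "[0..<m]" "fst g x q"]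
          permutes_in_image[OF \<pi>', of "fst g x q"] \<pi>' by simp
      moreover have "leaves t ! fst g x q = q" using mv s that by (simp add: moves_def)
      ultimately show ?thesis by (metis \<pi> permutes_inverses(1))
    qed
    then have "fst g x = \<pi>"
      using p \<pi> by (intro ext) (metis lessThan_iff permutes_not_in)
    with g mv s t show ?thesis by (auto simp: moves_def)
  qed
  have "?full x"
  proof (intro conjI equalityI subsetI)
    fix p assume "p \<in> point_perms \<phi> m x"
    then show "p \<in> carrier (Sym {..<m})"
      using hedron_wreath_fst[OF _ x] hedron_group_subset by (fastforce simp: point_perms_iff)
  next
    fix p assume "p \<in> carrier (Sym {..<m})"
    then show "p \<in> point_perms \<phi> m x" using *[OF x] by (simp add: point_perms_iff)
  next
    fix y assume "y \<in> orbit (hedron_group \<phi> m) snd x"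
    then show "y \<in> bracketings m"
      using permutes_in_image[OF hedron_wreath_snd] hedron_group_subset x
      by (fastforce simp: orbit_iff)
  next
    fix y assume "y \<in> bracketings m"
    then show "y \<in> orbit (hedron_group \<phi> m) snd x"
      using *[of y id] permutes_id by (auto simp: orbit_iff)
  qed
  with x show "\<exists>x \<in> bracketings m. ?full x" by blast
next
  assume "\<exists>x \<in> bracketings m. ?full x"
  then obtain x where x: "x \<in> bracketings m" and full: "?full x" by blast
  \<comment> \<open>Every product of \<open>m\<close> factors can be brought to the bracketing
    \<open>x\<close>: the orbit provides an element leading from \<open>x\<close> to the bracketing
    of \<open>s\<close>, and its inverse is applied to \<open>s\<close>.\<close>
  have to_x: "\<exists>s'. bracketing_of s' = x \<and> derivable \<phi> s s' \<and> mset (leaves s') = mset (leaves s)"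
    if len: "length (leaves s) = m" for s :: "'a gterm"
  proof -
    have "bracketing_of s \<in> orbit (hedron_group \<phi> m) snd x"
      using full len by (simp add: bracketing_of_in_bracketings)
    then obtain g where g: "g \<in> carrier (hedron_group \<phi> m)" "snd g x = bracketing_of s"
      by (auto simp: orbit_iff)
    interpret W: group "hedron_wreath m" by (intro group_wreath group_Sym)
    have g_W: "g \<in> carrier (hedron_wreath m)" using g hedron_group_subset by blast
    obtain s' where s': "moves m (inv\<^bsub>hedron_wreath m\<^esub> g) s s'"
      using moves_exists[of "inv\<^bsub>hedron_wreath m\<^esub> g" m s] g_W len
      by (auto simp: bracketing_of_in_bracketings)
    have mv: "moves m g s' s" using g_W s' by (rule moves_inv)
    have "snd g (bracketing_of s') = snd g x" using mv g by (simp add: moves_def)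
    then have "bracketing_of s' = x"
      using permutes_inj[OF hedron_wreath_snd[OF g_W]] by (simp add: inj_eq)
    with mv show ?thesis
      using hedron_group_moves_derivable[OF g(1) mv] moves_mset_leaves[OF g_W mv] derivable_sym
      by blast
  qed
  show ?nice
  proof (intro allI impI)
    fix C :: "'a set" and f
    assume C: "groupoid C f \<and> satisfies C f \<phi>"
    show "AC_nice m C f" unfolding AC_nice_def
    proof (intro allI impI)
      fix s t :: "'a gterm"
      assume st: "set (leaves s) \<subseteq> C \<and> length (leaves s) = m \<and> mset (leaves s) = mset (leaves t)"
      then have len: "length (leaves s) = m" "length (leaves t) = m" by (auto dest: mset_eq_length)
      obtain s' where
        s': "bracketing_of s' = x" "derivable \<phi> s s'" "mset (leaves s') = mset (leaves s)"
        using to_x[OF len(1)] by blast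
      obtain t' where
        t': "bracketing_of t' = x" "derivable \<phi> t t'" "mset (leaves t') = mset (leaves t)"
        using to_x[OF len(2)] by blast
      have len': "length (leaves t') = m" using t'(1) x by (metis bracketing_of_in_bracketings)
      have "mset (leaves s') = mset (leaves t')" using st s' t' by simp
      \<comment> \<open>With repeated letters \<pi> need not be unique, but any choice is the entry
        at \<open>x\<close> of an element of the stabilizer, since all permutations occur
        there.\<close>
      then obtain \<pi> where \<pi>: "\<pi> permutes {..<m}" "permute_list \<pi> (leaves t') = leaves s'"
        using mset_eq_permutation len' by metis
      then have "\<pi> \<in> point_perms \<phi> m x" using full by simp
      then obtain g where g: "g \<in> carrier (hedron_group \<phi> m)" "snd g x = x" "fst g x = \<pi>"
        by (auto simp: point_perms_iff)
      have "g \<in> carrier (hedron_wreath m)" using g hedron_group_subset by blast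
      then have "moves m g s' t'"
        using s' t' x g \<pi> by (simp add: moves_iff_permute_list)
      with g have "derivable \<phi> s' t'" by (intro hedron_group_moves_derivable)
      with s' t' have "derivable \<phi> s t" by (meson derivable_sym rtranclp_trans)
      with C st show "eval f id s = eval f id t"
        by (intro derivable_eval_eq[OF assms(1)]) auto
    qed
  qed
qed

end
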